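(* Let $\alpha,\lambda>0$, let $f\in V=\mathbb{R}^{N\times N}$, and let $$F_{\alpha,\lambda}(u,v)=\|\nabla u\|_{1,2}+\frac{\alpha}{2}\|f-u-v\|^2+\lambda\|v\|_{\mathrm{Lip}^*},\qquad (u,v)\in V\times V.$$ Let $u_0\in V$ be an initial guess and let $(u_n,v_n)$ be the sequence generated by the alternating minimization $$v_{n+1}=\operatorname*{arg\,min}_{v\in V}\ \frac{\alpha}{2}\|f-u_n-v\|^2+\lambda\|v\|_{\mathrm{Lip}^*},\qquad u_{n+1}=\operatorname*{arg\,min}_{u\in V}\ \|\nabla u\|_{1,2}+\frac{\alpha}{2}\|f-v_{n+1}-u\|^2,\qquad n\ge0.$$ Then $F_{\alpha,\lambda}(u_n,v_n)$ converges, as $n\to\infty$, to the unique minimum (minimum value) of $F_{\alpha,\lambda}$ on $V\times V$.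
   Context: $N$ is a positive integer (number of grid points per side), $h>0$ is the mesh size, $V=\mathbb{R}^{N\times N}$ and $Q=V\times V$. For $\phi\in V$: $\|\phi\|^2=\sum_{i,j}\phi_{(i,j)}^2$. For $m=(m_1,m_2)\in Q$: $\|m\|_{1,2}=\sum_{i,j}|m_{(i,j)}|$, where $|\cdot|$ is the Euclidean norm of $m_{(i,j)}=(m_{1(i,j)},m_{2(i,j)})\in\mathbb{R}^2$. The discrete gradient $\nabla=(\partial_x^+,\partial_y^+):V\to Q$ has periodic boundary conditions: $(\partial_x^+u)_{(i,j)}=(u_{(i+1,j)}-u_{(i,j)})/h$ for $1\le i\le N-1$ and $(\partial_x^+u)_{(N,j)}=(u_{(1,j)}-u_{(N,j)})/h$; $(\partial_y^+u)_{(i,j)}=(u_{(i,j+1)}-u_{(i,j)})/h$ for $1\le j\le N-1$ and $(\partial_y^+u)_{(i,N)}=(u_{(i,1)}-u_{(i,N)})/h$. The discrete divergence is $\mathrm{div}(m)=\partial_x^-m_1+\partial_y^-m_2$ with zero-flux boundary conditions: $(\partial_x^-m_1)_{(i,j)}$ equals $m_{1(1,j)}/h$ if $i=1$, $(m_{1(i,j)}-m_{1(i-1,j)})/h$ if $1<i<N$, and $-m_{1(N-1,j)}/h$ if $i=N$; $(\partial_y^-m_2)_{(i,j)}$ equals $m_{2(i,1)}/h$ if $j=1$, $(m_{2(i,j)}-m_{2(i,j-1)})/h$ if $1<j<N$, and $-m_{2(i,N-1)}/h$ if $j=N$. The discrete dual Lipschitz norm of $v\in V$ is $\|v\|_{\mathrm{Lip}^*}=\inf\{\|m\|_{1,2}:m\in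 Q,\ \mathrm{div}(m)=v\}$, equal to $+\infty$ if no such $m$ exists (in particular it is finite only if $\sum_{i,j}v_{(i,j)}=0$). *)

theory Defs
  imports "HOL-Analysis.Analysis"
begin

type_synonym field2d = "nat \<times> nat \<Rightarrow> real"

definition grid :: "nat \<Rightarrow> (nat \<times> nat) set" where
  "grid N = {1..N} \<times> {1..N}"

text \<open>
  The space of real N by N arrays, with indices starting at 1. An array is extended by zero outside
  the grid, so that arrays correspond bijectively to the elements of \<open>V N\<close> and equality of arrays
  is equality of functions.
\<close>

definition V :: "nat \<Rightarrow> field2d set" where
  "V N = {\<phi>. \<forall>p. p \<notin> grid N \<longrightarrow> \<phi> p = 0}"

definition Q :: "nat \<Rightarrow> (field2d \<times> field2d) set" where
  "Q N = V N \<times> V N"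

definition sq_norm :: "nat \<Rightarrow> field2d \<Rightarrow> real" where
  "sq_norm N \<phi> = (\<Sum>p\<in>grid N. (\<phi> p)\<^sup>2)"

text \<open>The norm on \<^typ>\<open>real \<times> real\<close> is the Euclidean one.\<close>

definition norm12 :: "nat \<Rightarrow> field2d \<times> field2d \<Rightarrow> real" where
  "norm12 N m = (\<Sum>p\<in>grid N. norm (fst m p, snd m p))"

definition dx_plus :: "nat \<Rightarrow> real \<Rightarrow> field2d \<Rightarrow> field2d" where
  "dx_plus N h u = (\<lambda>(i, j).
     if (i, j) \<notin> grid N then 0
     else if i < N then (u (i + 1, j) - u (i, j)) / h
     else (u (1, j) - u (N, j)) / h)"

definition dy_plus :: "nat \<Rightarrow> real \<Rightarrow> field2d \<Rightarrow> field2d" where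
  "dy_plus N h u = (\<lambda>(i, j).
     if (i, j) \<notin> grid N then 0
     else if j < N then (u (i, j + 1) - u (i, j)) / h
     else (u (i, 1) - u (i, N)) / h)"

definition discrete_grad :: "nat \<Rightarrow> real \<Rightarrow> field2d \<Rightarrow> field2d \<times> field2d" where
  "discrete_grad N h u = (dx_plus N h u, dy_plus N h u)"

text \<open>
  The clauses for the first and the last index overlap only if N = 1. The clause for the last index
  is tested first; for \<open>m \<in> V 1\<close> it yields 0, since \<open>m\<close> vanishes at index 0. This is the zero-flux
  condition, and the divergence of every field then sums to zero for N = 1 as well.
\<close>

definition dx_minus :: "nat \<Rightarrow> real \<Rightarrow> field2d \<Rightarrow> field2d" where
  "dx_minus N h m = (\<lambda>(i, j).
     if (i, j) \<notin> grid N then 0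
     else if i = N then - m (N - 1, j) / h
     else if i = 1 then m (1, j) / h
     else (m (i, j) - m (i - 1, j)) / h)"

definition dy_minus :: "nat \<Rightarrow> real \<Rightarrow> field2d \<Rightarrow> field2d" where
  "dy_minus N h m = (\<lambda>(i, j).
     if (i, j) \<notin> grid N then 0
     else if j = N then - m (i, N - 1) / h
     else if j = 1 then m (i, 1) / h
     else (m (i, j) - m (i, j - 1)) / h)"

definition discrete_div :: "nat \<Rightarrow> real \<Rightarrow> field2d \<times> field2d \<Rightarrow> field2d" where
  "discrete_div N h m = (\<lambda>p. dx_minus N h (fst m) p + dy_minus N h (snd m) p)"

text \<open>The infimum of the empty set of extended reals is \<open>\<infinity>\<close>.\<close>

definition lip_dual_norm :: "nat \<Rightarrow> real \<Rightarrow> field2d \<Rightarrow> ereal" where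
  "lip_dual_norm N h v = (INF m\<in>{m \<in> Q N. discrete_div N h m = v}. ereal (norm12 N m))"

definition F :: "nat \<Rightarrow> real \<Rightarrow> real \<Rightarrow> real \<Rightarrow> field2d \<Rightarrow> field2d \<times> field2d \<Rightarrow> ereal" where
  "F N h \<alpha> lam f = (\<lambda>(u, v).
     ereal (norm12 N (discrete_grad N h u))
     + ereal (\<alpha> / 2 * sq_norm N (\<lambda>p. f p - u p - v p))
     + ereal lam * lip_dual_norm N h v)"

definition is_minimum :: "('a \<Rightarrow> 'b::order) \<Rightarrow> 'a set \<Rightarrow> 'b \<Rightarrow> bool" where
  "is_minimum g S \<mu> \<longleftrightarrow> (\<exists>x\<in>S. g x = \<mu>) \<and> (\<forall>x\<in>S. \<mu> \<le> g x)"

end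

theory Submission
  imports Defs
begin

text \<open>
  Write \<open>J u = norm12 (grad u)\<close> and \<open>G v = lam * lip_dual_norm v\<close>; both are convex, and \<open>F\<close> couples
  them only through the quadratic \<open>\<alpha>/2 |f - u - v|\<^sup>2\<close>.

  Convergence. Each half step minimizes a convex function plus a quadratic, so its minimizer satisfies
  a variational inequality (\<open>prox_variational_inequality\<close>). Let \<open>(us, vs)\<close> be a minimizer of \<open>F\<close>. Testing
  the two half steps with \<open>vs\<close> and \<open>us\<close> and adding, the terms with \<open>J\<close>, \<open>G\<close> and the quadratics combine,
  by completing a square, to
  \<open>F (u', v') - F (us, vs) \<le> \<alpha>/2 (|us - u|\<^sup>2 - |us - u'|\<^sup>2)\<close>
  for one step from \<open>u\<close> to \<open>(u', v')\<close> (\<open>alternating_step_estimate\<close>). The right-hand side telescopes,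
  hence the nonnegative gaps \<open>F (u n, v n) - F (us, vs)\<close> are summable and tend to zero.

  Existence of \<open>(us, vs)\<close>. The dual norm is an infimum over fields \<open>m\<close> with \<open>div m = v\<close> and may be
  infinite. Minimizing jointly over \<open>u\<close> and \<open>m\<close> instead, with \<open>v = div m\<close>, gives a finite continuous
  function (\<open>lifted\<close>). It is coercive: a bound on its value bounds \<open>m\<close> by the last term, hence \<open>div m\<close>,
  hence \<open>u\<close> by the quadratic term. So it has a minimum (\<open>lifted_minimum_exists\<close>), which is also
  the minimum of \<open>F\<close> (\<open>lifted_minimum_is_minimum_F\<close>).
\<close>

section \<open>Line segments and convexity of the two regularizers\<close>

definition inner_grid :: "nat \<Rightarrow> field2d \<Rightarrow> field2d \<Rightarrow> real" where
  "inner_grid N a b = (\<Sum>p\<in>grid N. a p * b p)"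

definition seg :: "real \<Rightarrow> field2d \<Rightarrow> field2d \<Rightarrow> field2d" where
  "seg t x y = (\<lambda>p. x p + t * (y p - x p))"

lemma finite_grid [simp]: "finite (grid N)"
  by (simp add: grid_def)

lemma seg_in_V: "x \<in> V N \<Longrightarrow> y \<in> V N \<Longrightarrow> seg t x y \<in> V N"
  by (simp add: V_def seg_def)

lemma discrete_div_in_V: "discrete_div N h m \<in> V N"
  by (auto simp: V_def discrete_div_def dx_minus_def dy_minus_def)

lemma discrete_grad_seg:
  "discrete_grad N h (seg t x y) =
    (seg t (fst (discrete_grad N h x)) (fst (discrete_grad N h y)),
     seg t (snd (discrete_grad N h x)) (snd (discrete_grad N h y)))"
  by (simp add: discrete_grad_def seg_def dx_plus_def dy_plus_def fun_eq_iff divide_simps)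
     (auto simp: algebra_simps)

lemma discrete_div_seg:
  "discrete_div N h (seg t (fst m) (fst m'), seg t (snd m) (snd m')) =
    seg t (discrete_div N h m) (discrete_div N h m')"
  by (simp add: discrete_div_def seg_def dx_minus_def dy_minus_def fun_eq_iff divide_simps)
     (auto simp: algebra_simps)

lemma norm12_nonneg: "0 \<le> norm12 N m"
  by (simp add: norm12_def sum_nonneg)

lemma sq_norm_nonneg: "0 \<le> sq_norm N a"
  by (simp add: sq_norm_def sum_nonneg)

lemma norm12_convex:
  assumes "0 \<le> t" "t \<le> 1"
  shows "norm12 N (seg t (fst m) (fst m'), seg t (snd m) (snd m'))
    \<le> (1 - t) * norm12 N m + t * norm12 N m'"
proof -
  have "norm (seg t (fst m) (fst m') p, seg t (snd m) (snd m') p)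
      \<le> (1 - t) * norm (fst m p, snd m p) + t * norm (fst m' p, snd m' p)" for p
  proof -
    have "(seg t (fst m) (fst m') p, seg t (snd m) (snd m') p)
        = (1 - t) *\<^sub>R (fst m p, snd m p) + t *\<^sub>R (fst m' p, snd m' p)"
      by (simp add: seg_def algebra_simps)
    also have "norm \<dots> \<le> norm ((1 - t) *\<^sub>R (fst m p, snd m p)) + norm (t *\<^sub>R (fst m' p, snd m' p))"
      by (rule norm_triangle_ineq)
    also have "\<dots> = (1 - t) * norm (fst m p, snd m p) + t * norm (fst m' p, snd m' p)"
      using assms by (simp only: norm_scaleR)
    finally show ?thesis .
  qed
  then show ?thesis
    by (simp add: norm12_def sum_distrib_left sum_mono flip: sum.distrib)
qed

lemma total_variation_convex:
  assumes "0 \<le> t" "t \<le> 1"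
  shows "norm12 N (discrete_grad N h (seg t x y))
    \<le> (1 - t) * norm12 N (discrete_grad N h x) + t * norm12 N (discrete_grad N h y)"
  using norm12_convex[OF assms] by (simp add: discrete_grad_seg)

lemma lip_dual_norm_nonneg: "0 \<le> lip_dual_norm N h v"
  unfolding lip_dual_norm_def by (intro INF_greatest) (simp add: norm12_nonneg)

lemma lip_dual_norm_div_le:
  "m \<in> Q N \<Longrightarrow> lip_dual_norm N h (discrete_div N h m) \<le> ereal (norm12 N m)"
  unfolding lip_dual_norm_def by (intro INF_lower) auto

lemma lip_dual_norm_zero: "lip_dual_norm N h (\<lambda>p. 0) = 0"
proof (rule antisym)
  have "discrete_div N h (\<lambda>p. 0, \<lambda>p. 0) = (\<lambda>p. 0)"
    by (auto simp: discrete_div_def dx_minus_def dy_minus_def fun_eq_iff)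
  then show "lip_dual_norm N h (\<lambda>p. 0) \<le> 0"
    using lip_dual_norm_div_le[of "(\<lambda>p. 0, \<lambda>p. 0)" N h]
    by (simp add: Q_def V_def norm12_def zero_ereal_def)
qed (rule lip_dual_norm_nonneg)

text \<open>
  The dual norm where it is finite; where it is infinite, the value is the meaningless default 0, so
  every use comes with a finiteness proof.
\<close>

definition lip_real :: "nat \<Rightarrow> real \<Rightarrow> field2d \<Rightarrow> real" where
  "lip_real N h v = real_of_ereal (lip_dual_norm N h v)"

lemma ereal_lip_real:
  "lip_dual_norm N h v \<noteq> \<infinity> \<Longrightarrow> ereal (lip_real N h v) = lip_dual_norm N h v"
  using lip_dual_norm_nonneg[of N h v] by (simp add: lip_real_def ereal_real)

text \<open>
  Nearly optimal fields for \<open>x\<close> and \<open>y\<close> combine to a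
  field that is feasible for the point on the segment, because the divergence is linear, and its norm
  is controlled by convexity of \<open>norm12\<close>.
\<close>

lemma lip_dual_norm_convex:
  assumes x: "lip_dual_norm N h x \<noteq> \<infinity>" and y: "lip_dual_norm N h y \<noteq> \<infinity>"
    and t: "0 \<le> t" "t \<le> 1"
  shows "lip_dual_norm N h (seg t x y) \<le> ereal ((1 - t) * lip_real N h x + t * lip_real N h y)"
proof (rule ereal_le_epsilon2)
  have approx: "\<exists>m\<in>Q N. discrete_div N h m = w \<and> norm12 N m < lip_real N h w + e"
    if "lip_dual_norm N h w \<noteq> \<infinity>" "0 < e" for w e
  proof -
    have "lip_dual_norm N h w < ereal (lip_real N h w + e)"
      using that by (simp flip: ereal_lip_real)
    then show ?thesis
      unfolding lip_dual_norm_def by (auto simp: INF_less_iff)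
  qed
  fix e :: real assume e: "0 < e"
  obtain m where m: "m \<in> Q N" "discrete_div N h m = x" "norm12 N m < lip_real N h x + e"
    using approx[OF x e] by blast
  obtain m' where m': "m' \<in> Q N" "discrete_div N h m' = y" "norm12 N m' < lip_real N h y + e"
    using approx[OF y e] by blast
  let ?M = "(seg t (fst m) (fst m'), seg t (snd m) (snd m'))"
  have "?M \<in> Q N" using m(1) m'(1) by (auto simp: Q_def seg_in_V)
  then have "lip_dual_norm N h (seg t x y) \<le> ereal (norm12 N ?M)"
    using lip_dual_norm_div_le[of ?M N h] by (simp add: discrete_div_seg m m')
  also have "norm12 N ?M \<le> (1 - t) * norm12 N m + t * norm12 N m'"
    by (rule norm12_convex[OF t])
  also have "\<dots> \<le> (1 - t) * (lip_real N h x + e) + t * (lip_real N h y + e)"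
    using m m' t by (intro add_mono mult_left_mono) auto
  also have "\<dots> = (1 - t) * lip_real N h x + t * lip_real N h y + e"
    by (simp add: algebra_simps)
  finally show "lip_dual_norm N h (seg t x y)
      \<le> ereal ((1 - t) * lip_real N h x + t * lip_real N h y) + ereal e"
    by simp
qed

section \<open>The descent estimate of one alternating step\<close>

lemma sq_norm_seg:
  "sq_norm N (\<lambda>p. c p - seg t x y p) = sq_norm N (\<lambda>p. c p - x p)
     - 2 * t * inner_grid N (\<lambda>p. c p - x p) (\<lambda>p. y p - x p)
     + t\<^sup>2 * sq_norm N (\<lambda>p. y p - x p)"
  unfolding sq_norm_def inner_grid_def seg_def sum_distrib_left
    sum_subtractf[symmetric] sum.distrib[symmetric]
  by (intro sum.cong refl) (simp add: power2_eq_square algebra_simps)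

text \<open>
  First-order optimality without derivatives of \<open>g\<close>: comparing \<open>x\<close> with a point at parameter \<open>t\<close> on the
  segment to \<open>y\<close>, the linear terms are of order \<open>t\<close> and the leftover square is of order \<open>t\<^sup>2\<close>, so
  dividing by \<open>t\<close> and letting \<open>t\<close> tend to 0 makes \<open>\<alpha> (c - x)\<close> act as a subgradient
  of \<open>g\<close> at \<open>x\<close> in the direction of \<open>y\<close>.
  Convexity and minimality are
  required on this segment alone, because the dual norm is real-valued only on a convex subset.
\<close>

lemma prox_variational_inequality:
  assumes convex: "\<And>t. 0 < t \<Longrightarrow> t \<le> 1 \<Longrightarrow> g (seg t x y) \<le> (1 - t) * g x + t * g y"
    and minimal: "\<And>t. 0 < t \<Longrightarrow> t \<le> 1 \<Longrightarrow>
      g x + \<alpha> / 2 * sq_norm N (\<lambda>p. c p - x p)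
        \<le> g (seg t x y) + \<alpha> / 2 * sq_norm N (\<lambda>p. c p - seg t x y p)"
  shows "g x + \<alpha> * inner_grid N (\<lambda>p. c p - x p) (\<lambda>p. y p - x p) \<le> g y"
proof -
  define A where "A = g x - g y + \<alpha> * inner_grid N (\<lambda>p. c p - x p) (\<lambda>p. y p - x p)"
  define B where "B = \<alpha> / 2 * sq_norm N (\<lambda>p. y p - x p)"
  have "A \<le> t * B" if t: "0 < t" "t \<le> 1" for t
  proof -
    have "t * A \<le> t * (t * B)"
      using minimal[OF t] convex[OF t]
      unfolding A_def B_def sq_norm_seg by (simp add: algebra_simps power2_eq_square)
    with t show ?thesis by simp
  qed
  then have "eventually (\<lambda>t. A \<le> t * B) (at_right 0)"
    unfolding eventually_at_right_field by (intro exI[of _ 1]) auto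
  moreover have "((\<lambda>t. t * B) \<longlongrightarrow> 0 * B) (at_right 0)"
    by (intro tendsto_intros)
  ultimately have "A \<le> 0"
    using tendsto_lowerbound[of "\<lambda>t. t * B" "0 * B" "at_right 0" A] by simp
  then show ?thesis by (simp add: A_def)
qed

text \<open>
  The \<open>v\<close>-step is optimal for the residual \<open>f - u - v'\<close> with the old \<open>u\<close>, the \<open>u\<close>-step for the residual
  with the new \<open>u'\<close>. This mismatch is what produces the distances from \<open>us\<close> to \<open>u\<close> and to \<open>u'\<close>.
\<close>

lemma alternating_step_estimate:
  assumes \<alpha>: "0 \<le> \<alpha>"
    and v_opt: "G v' + \<alpha> * inner_grid N (\<lambda>p. f p - u p - v' p) (\<lambda>p. vs p - v' p) \<le> G vs"
    and u_opt: "J u' + \<alpha> * inner_grid N (\<lambda>p. f p - v' p - u' p) (\<lambda>p. us p - u' p) \<le> J us"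
  shows "(J u' + \<alpha> / 2 * sq_norm N (\<lambda>p. f p - u' p - v' p) + G v')
       - (J us + \<alpha> / 2 * sq_norm N (\<lambda>p. f p - us p - vs p) + G vs)
     \<le> \<alpha> / 2 * (sq_norm N (\<lambda>p. us p - u p) - sq_norm N (\<lambda>p. us p - u' p))"
proof -
  \<comment> \<open>With \<open>r = f - u' - v'\<close>, \<open>a = us - u'\<close>, \<open>b = vs - v'\<close> and \<open>d = u - u'\<close>, the left-hand side is
    \<open>|r|\<^sup>2 - |r - a - b|\<^sup>2 - 2\<langle>r - d, b\<rangle> - 2\<langle>r, a\<rangle> = 2\<langle>d, b\<rangle> - |a + b|\<^sup>2 = |a - d|\<^sup>2 - |a|\<^sup>2 - |a + b - d|\<^sup>2\<close>.\<close>
  have "sq_norm N (\<lambda>p. f p - u' p - v' p) - sq_norm N (\<lambda>p. f p - us p - vs p)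
      - 2 * inner_grid N (\<lambda>p. f p - u p - v' p) (\<lambda>p. vs p - v' p)
      - 2 * inner_grid N (\<lambda>p. f p - v' p - u' p) (\<lambda>p. us p - u' p)
    = sq_norm N (\<lambda>p. us p - u p) - sq_norm N (\<lambda>p. us p - u' p)
      - sq_norm N (\<lambda>p. us p - u p + vs p - v' p)"
    unfolding sq_norm_def inner_grid_def sum_distrib_left sum_subtractf[symmetric]
    by (intro sum.cong refl) (simp add: power2_eq_square algebra_simps)
  also have "\<dots> \<le> sq_norm N (\<lambda>p. us p - u p) - sq_norm N (\<lambda>p. us p - u' p)"
    using sq_norm_nonneg by simp
  finally have "\<alpha> / 2 * (sq_norm N (\<lambda>p. f p - u' p - v' p) - sq_norm N (\<lambda>p. f p - us p - vs p)
      - 2 * inner_grid N (\<lambda>p. f p - u p - v' p) (\<lambda>p. vs p - v' p)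
      - 2 * inner_grid N (\<lambda>p. f p - v' p - u' p) (\<lambda>p. us p - u' p))
    \<le> \<alpha> / 2 * (sq_norm N (\<lambda>p. us p - u p) - sq_norm N (\<lambda>p. us p - u' p))"
    using \<alpha> by (intro mult_left_mono) auto
  then show ?thesis
    using v_opt u_opt by (simp add: algebra_simps)
qed

lemma telescoping_null_sequence:
  fixes e s :: "nat \<Rightarrow> real"
  assumes e: "\<And>n. 0 \<le> e n" and s: "\<And>n. 0 \<le> s n" and es: "\<And>n. e n \<le> s n - s (Suc n)"
  shows "e \<longlonglongrightarrow> 0"
proof -
  have "(\<Sum>i<n. e i) \<le> s 0 - s n" for n
  proof (induction n)
    case (Suc n)
    then show ?case using es[of n] by simp
  qed simp
  then have "(\<Sum>i\<le>n. e i) \<le> s 0" for n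
    using s[of "Suc n"] by (smt (verit) lessThan_Suc_atMost)
  then have "summable e"
    using e by (intro bounded_imp_summable[where B = "s 0"])
  then show ?thesis
    by (rule summable_LIMSEQ_zero)
qed

section \<open>Existence of a minimizer\<close>

text \<open>
  The energy with the infimum in the dual norm removed: \<open>F (u, v)\<close> is the infimum of \<open>lifted u m\<close> over
  the fields \<open>m\<close> with divergence \<open>v\<close>.
\<close>

definition lifted :: "nat \<Rightarrow> real \<Rightarrow> real \<Rightarrow> real \<Rightarrow> field2d \<Rightarrow> field2d \<Rightarrow> field2d \<times> field2d \<Rightarrow> real" where
  "lifted N h \<alpha> lam f u m = norm12 N (discrete_grad N h u)
     + \<alpha> / 2 * sq_norm N (\<lambda>p. f p - u p - discrete_div N h m p) + lam * norm12 N m"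

definition grid_box :: "nat \<Rightarrow> real \<Rightarrow> field2d set" where
  "grid_box N R = {\<phi> \<in> V N. \<forall>p\<in>grid N. \<bar>\<phi> p\<bar> \<le> R}"

text \<open>
  Arrays are functions on all index pairs, so compactness is Tychonoff's theorem, with the factor
  \<open>{0}\<close> at every index outside the grid.
\<close>

lemma compact_grid_box: "compact (grid_box N R)"
proof -
  have "compactin (product_topology (\<lambda>i. euclidean) UNIV)
      (PiE UNIV (\<lambda>p. if p \<in> grid N then {-R..R} else {0::real}))"
    by (auto simp: compactin_PiE)
  moreover have "PiE UNIV (\<lambda>p. if p \<in> grid N then {-R..R} else {0::real}) = grid_box N R"
    by (auto simp: grid_box_def V_def PiE_def Pi_def abs_le_iff) (smt (verit))+
  ultimately show ?thesis
    by (simp add: euclidean_product_topology)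
qed

lemma continuous_on_eval:
  fixes g :: "'a::topological_space \<Rightarrow> 'b \<Rightarrow> real"
  assumes "continuous_on S g"
  shows "continuous_on S (\<lambda>x. g x p)"
  using continuous_on_product_then_coordinatewise[OF assms] .

lemma continuous_on_if_const:
  assumes "c \<Longrightarrow> continuous_on S f" "\<not> c \<Longrightarrow> continuous_on S g"
  shows "continuous_on S (\<lambda>x. if c then f x else g x)"
  using assms by (cases c) simp_all

lemma continuous_on_lifted:
  "continuous_on S (\<lambda>x. lifted N h \<alpha> lam f (fst x) (snd x))"
proof -
  have coords: "continuous_on S (\<lambda>x. fst x q)" "continuous_on S (\<lambda>x. fst (snd x) q)"
    "continuous_on S (\<lambda>x. snd (snd x) q)" for q
    by (intro continuous_on_eval continuous_intros)+
  have grad_x: "continuous_on S (\<lambda>x. dx_plus N h (fst x) p)" for p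
    unfolding dx_plus_def
    by (cases p) (auto simp: divide_inverse intro!: continuous_on_if_const continuous_on_mult
      continuous_on_diff continuous_on_minus continuous_on_const coords)
  have grad_y: "continuous_on S (\<lambda>x. dy_plus N h (fst x) p)" for p
    unfolding dy_plus_def
    by (cases p) (auto simp: divide_inverse intro!: continuous_on_if_const continuous_on_mult
      continuous_on_diff continuous_on_minus continuous_on_const coords)
  have div_x: "continuous_on S (\<lambda>x. dx_minus N h (fst (snd x)) p)" for p
    unfolding dx_minus_def
    by (cases p) (auto simp: divide_inverse intro!: continuous_on_if_const continuous_on_mult
      continuous_on_diff continuous_on_minus continuous_on_const coords)
  have div_y: "continuous_on S (\<lambda>x. dy_minus N h (snd (snd x)) p)" for p
    unfolding dy_minus_def
    by (cases p) (auto simp: divide_inverse intro!: continuous_on_if_const continuous_on_mult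
      continuous_on_diff continuous_on_minus continuous_on_const coords)
  show ?thesis
    unfolding lifted_def norm12_def sq_norm_def discrete_grad_def discrete_div_def fst_conv snd_conv
    by (intro continuous_intros grad_x grad_y div_x div_y coords)
qed

lemma abs_le_norm12:
  assumes "p \<in> grid N"
  shows "\<bar>fst m p\<bar> \<le> norm12 N m" "\<bar>snd m p\<bar> \<le> norm12 N m"
proof -
  have *: "norm (fst m p, snd m p) \<le> norm12 N m"
    unfolding norm12_def using assms by (intro member_le_sum) auto
  show "\<bar>fst m p\<bar> \<le> norm12 N m" using * norm_fst_le[of "(fst m p)" "snd m p"] by simp
  show "\<bar>snd m p\<bar> \<le> norm12 N m" using * norm_snd_le[of "(snd m p)" "fst m p"] by simp
qed

text \<open>At each point the divergence is \<open>1 / h\<close> times a signed sum of at most four components of \<open>m\<close>.\<close>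

lemma abs_discrete_div_le:
  assumes h: "0 < h" and m: "m \<in> Q N"
  shows "\<bar>discrete_div N h m p\<bar> \<le> 4 * norm12 N m / h"
proof -
  have b: "\<bar>fst m q\<bar> \<le> norm12 N m" "\<bar>snd m q\<bar> \<le> norm12 N m" for q
    using abs_le_norm12[of q N m] m norm12_nonneg[of N m]
    by (atomize (full), cases "q \<in> grid N") (auto simp: Q_def V_def simp del: split_paired_All)
  obtain i j where p: "p = (i, j)" by (cases p)
  have terms: "\<bar>fst m q\<bar> \<le> 2 * norm12 N m" "\<bar>fst m q - fst m q'\<bar> \<le> 2 * norm12 N m"
    "\<bar>snd m q\<bar> \<le> 2 * norm12 N m" "\<bar>snd m q - snd m q'\<bar> \<le> 2 * norm12 N m" for q q'
    using b[of q] b[of q'] by linarith+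
  have "\<bar>h * dx_minus N h (fst m) p\<bar> \<le> 2 * norm12 N m"
    using h by (simp add: p dx_minus_def terms norm12_nonneg)
  moreover have "\<bar>h * dy_minus N h (snd m) p\<bar> \<le> 2 * norm12 N m"
    using h by (simp add: p dy_minus_def terms norm12_nonneg)
  ultimately have "\<bar>h * discrete_div N h m p\<bar> \<le> 4 * norm12 N m"
    unfolding discrete_div_def distrib_left by linarith
  then show ?thesis using h by (simp add: abs_mult field_simps)
qed

text \<open>
  Where \<open>lifted\<close> is at most its value at the zero fields, all components lie in a fixed compact box;
  a minimizer on that box is therefore a global one.
\<close>

lemma lifted_minimum_exists:
  assumes h: "0 < h" and \<alpha>: "0 < \<alpha>" and lam: "0 < lam"
  shows "\<exists>us\<in>V N. \<exists>ms\<in>Q N. \<forall>u\<in>V N. \<forall>m\<in>Q N. lifted N h \<alpha> lam f us ms \<le> lifted N h \<alpha> lam f u m"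
proof -
  define K where "K = lifted N h \<alpha> lam f (\<lambda>p. 0) (\<lambda>p. 0, \<lambda>p. 0)"
  have K: "0 \<le> K"
    using \<alpha> lam by (simp add: K_def lifted_def norm12_nonneg sq_norm_nonneg)
  \<comment> \<open>Since \<open>u = f - r - div m\<close> with the residual \<open>r\<close>, the four summands bound \<open>m\<close>, \<open>f\<close>, \<open>r\<close> and
    \<open>div m\<close>, in this order, wherever the energy is at most \<open>K\<close>.\<close>
  define R where "R = K / lam + sqrt (sq_norm N f) + sqrt (2 * K / \<alpha>) + 4 * (K / lam) / h"
  have R: "0 \<le> R" "K / lam \<le> R"
    using K h \<alpha> lam by (auto simp: R_def sq_norm_nonneg)
  have sqrt_bound: "\<bar>a p\<bar> \<le> sqrt (sq_norm N a)" if "p \<in> grid N" for a p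
  proof (rule real_le_rsqrt)
    show "\<bar>a p\<bar>\<^sup>2 \<le> sq_norm N a"
      unfolding sq_norm_def using that member_le_sum[of p "grid N" "\<lambda>p. (a p)\<^sup>2"] by simp
  qed
  have bounded: "u \<in> grid_box N R \<and> fst m \<in> grid_box N R \<and> snd m \<in> grid_box N R"
    if u: "u \<in> V N" and m: "m \<in> Q N" and le: "lifted N h \<alpha> lam f u m \<le> K" for u m
  proof -
    let ?r = "\<lambda>p. f p - u p - discrete_div N h m p"
    have "lam * norm12 N m \<le> K" "\<alpha> / 2 * sq_norm N ?r \<le> K"
      using le \<alpha> lam norm12_nonneg[of N "discrete_grad N h u"]
        mult_nonneg_nonneg[of lam "norm12 N m"] mult_nonneg_nonneg[of "\<alpha> / 2" "sq_norm N ?r"]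
        norm12_nonneg[of N m] sq_norm_nonneg[of N ?r]
      unfolding lifted_def by linarith+
    then have m_le: "norm12 N m \<le> K / lam" and r_le: "sq_norm N ?r \<le> 2 * K / \<alpha>"
      using \<alpha> lam by (simp_all add: field_simps)
    have "\<bar>u p\<bar> \<le> R" if p: "p \<in> grid N" for p
    proof -
      have "\<bar>discrete_div N h m p\<bar> \<le> 4 * norm12 N m / h"
        by (rule abs_discrete_div_le[OF h m])
      also have "\<dots> \<le> 4 * (K / lam) / h"
        using m_le h by (intro divide_right_mono) auto
      finally have "\<bar>discrete_div N h m p\<bar> \<le> 4 * (K / lam) / h" .
      moreover have "\<bar>?r p\<bar> \<le> sqrt (2 * K / \<alpha>)"
        using sqrt_bound[OF p, of ?r] real_sqrt_le_mono[OF r_le] by linarith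
      moreover have "0 \<le> K / lam" using K lam by simp
      ultimately show ?thesis
        using sqrt_bound[OF p, of f] unfolding R_def by linarith
    qed
    moreover have "\<bar>fst m p\<bar> \<le> R" "\<bar>snd m p\<bar> \<le> R" if "p \<in> grid N" for p
      using abs_le_norm12[OF that, of m] m_le R by linarith+
    ultimately show ?thesis
      using u m by (auto simp: grid_box_def Q_def)
  qed
  let ?B = "grid_box N R \<times> grid_box N R \<times> grid_box N R"
  have zero: "(\<lambda>p. 0, \<lambda>p. 0, \<lambda>p. 0) \<in> ?B"
    using R by (auto simp: grid_box_def V_def)
  have "\<exists>x\<in>?B. \<forall>y\<in>?B. lifted N h \<alpha> lam f (fst x) (snd x) \<le> lifted N h \<alpha> lam f (fst y) (snd y)"
    using zero by (intro continuous_attains_inf continuous_on_lifted compact_Times compact_grid_box) blast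
  then obtain x where x: "x \<in> ?B"
    and min: "\<And>y. y \<in> ?B \<Longrightarrow> lifted N h \<alpha> lam f (fst x) (snd x) \<le> lifted N h \<alpha> lam f (fst y) (snd y)"
    by blast
  have "lifted N h \<alpha> lam f (fst x) (snd x) \<le> lifted N h \<alpha> lam f u m"
    if "u \<in> V N" "m \<in> Q N" for u m
  proof (cases "lifted N h \<alpha> lam f u m \<le> K")
    case True
    then show ?thesis
      using bounded[OF that] min[of "(u, m)"] by (auto simp: mem_Times_iff)
  next
    case False
    then show ?thesis
      using min[OF zero] by (simp add: K_def)
  qed
  with x show ?thesis
    by (intro bexI[of _ "fst x"] bexI[of _ "snd x"]) (auto simp: grid_box_def Q_def)
qed

lemma lifted_minimum_is_minimum_F:
  assumes lam: "0 < lam" and us: "us \<in> V N" and ms: "ms \<in> Q N"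
    and min: "\<And>u m. u \<in> V N \<Longrightarrow> m \<in> Q N \<Longrightarrow> lifted N h \<alpha> lam f us ms \<le> lifted N h \<alpha> lam f u m"
  shows "F N h \<alpha> lam f (us, discrete_div N h ms) = ereal (lifted N h \<alpha> lam f us ms)"
    and "u \<in> V N \<Longrightarrow> ereal (lifted N h \<alpha> lam f us ms) \<le> F N h \<alpha> lam f (u, v)"
proof -
  let ?L = "lifted N h \<alpha> lam f us ms"
  have lower: "ereal ?L \<le> F N h \<alpha> lam f (u, v)" if u: "u \<in> V N" for u v
  proof -
    \<comment> \<open>The bound on the dual norm that the claim needs. As a lower bound on all feasible \<open>m\<close> it covers
      the case without a feasible \<open>m\<close>, where the dual norm is infinite.\<close>
    define c where "c = (?L - norm12 N (discrete_grad N h u)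
      - \<alpha> / 2 * sq_norm N (\<lambda>p. f p - u p - v p)) / lam"
    have "ereal c \<le> lip_dual_norm N h v"
      unfolding lip_dual_norm_def
    proof (rule INF_greatest)
      fix m assume "m \<in> {m \<in> Q N. discrete_div N h m = v}"
      then have "?L \<le> norm12 N (discrete_grad N h u)
          + \<alpha> / 2 * sq_norm N (\<lambda>p. f p - u p - v p) + lam * norm12 N m"
        using min[OF u, of m] by (auto simp: lifted_def)
      then show "ereal c \<le> ereal (norm12 N m)"
        using lam by (simp add: c_def pos_divide_le_eq algebra_simps)
    qed
    then have "ereal lam * ereal c \<le> ereal lam * lip_dual_norm N h v"
      using lam by (intro ereal_mult_left_mono) auto
    then have "ereal (norm12 N (discrete_grad N h u))
        + ereal (\<alpha> / 2 * sq_norm N (\<lambda>p. f p - u p - v p)) + ereal lam * ereal c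
      \<le> F N h \<alpha> lam f (u, v)"
      unfolding F_def prod.case by (rule add_left_mono)
    moreover have "norm12 N (discrete_grad N h u)
        + \<alpha> / 2 * sq_norm N (\<lambda>p. f p - u p - v p) + lam * c = ?L"
      using lam by (simp add: c_def)
    ultimately show ?thesis by simp
  qed
  show "u \<in> V N \<Longrightarrow> ereal ?L \<le> F N h \<alpha> lam f (u, v)" by (rule lower)
  have "ereal lam * lip_dual_norm N h (discrete_div N h ms) \<le> ereal lam * ereal (norm12 N ms)"
    using lam ms by (intro ereal_mult_left_mono lip_dual_norm_div_le) auto
  then have "F N h \<alpha> lam f (us, discrete_div N h ms)
      \<le> ereal (norm12 N (discrete_grad N h us))
        + ereal (\<alpha> / 2 * sq_norm N (\<lambda>p. f p - us p - discrete_div N h ms p))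
        + ereal lam * ereal (norm12 N ms)"
    unfolding F_def prod.case by (rule add_left_mono)
  also have "\<dots> = ereal ?L" by (simp add: lifted_def)
  finally show "F N h \<alpha> lam f (us, discrete_div N h ms) = ereal ?L"
    using lower[OF us] by (intro antisym) auto
qed

section \<open>Alternating minimization\<close>

lemma F_finite:
  assumes "lip_dual_norm N h v \<noteq> \<infinity>"
  shows "F N h \<alpha> lam f (u, v) = ereal (norm12 N (discrete_grad N h u)
    + \<alpha> / 2 * sq_norm N (\<lambda>p. f p - u p - v p) + lam * lip_real N h v)"
  using assms by (simp add: F_def flip: ereal_lip_real)

text \<open>
  Comparison with \<open>w = 0\<close> shows that the minimizer has finite dual norm; convexity then keeps the dual
  norm finite along segments to any \<open>w\<close> of finite dual norm, so the real-valued inequality applies.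
\<close>

lemma v_step_variational_inequality:
  assumes lam: "0 < lam"
    and opt: "is_arg_min (\<lambda>w. ereal (\<alpha> / 2 * sq_norm N (\<lambda>p. c p - w p))
      + ereal lam * lip_dual_norm N h w) (\<lambda>w. w \<in> V N) v"
  shows "lip_dual_norm N h v \<noteq> \<infinity>"
    and "\<lbrakk>w \<in> V N; lip_dual_norm N h w \<noteq> \<infinity>\<rbrakk> \<Longrightarrow>
      lam * lip_real N h v + \<alpha> * inner_grid N (\<lambda>p. c p - v p) (\<lambda>p. w p - v p) \<le> lam * lip_real N h w"
proof -
  let ?E = "\<lambda>w. ereal (\<alpha> / 2 * sq_norm N (\<lambda>p. c p - w p)) + ereal lam * lip_dual_norm N h w"
  have v: "v \<in> V N" and min: "\<And>w. w \<in> V N \<Longrightarrow> ?E v \<le> ?E w"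
    using opt by (auto simp: is_arg_min_def not_less)
  have "?E v \<le> ?E (\<lambda>p. 0)" by (rule min) (simp add: V_def)
  then show fin: "lip_dual_norm N h v \<noteq> \<infinity>"
    using lam by (auto simp: lip_dual_norm_zero)
  assume w: "w \<in> V N" and fw: "lip_dual_norm N h w \<noteq> \<infinity>"
  show "lam * lip_real N h v + \<alpha> * inner_grid N (\<lambda>p. c p - v p) (\<lambda>p. w p - v p) \<le> lam * lip_real N h w"
  proof (rule prox_variational_inequality[where g = "\<lambda>w. lam * lip_real N h w"])
    fix t :: real assume t: "0 < t" "t \<le> 1"
    have conv: "lip_dual_norm N h (seg t v w) \<le> ereal ((1 - t) * lip_real N h v + t * lip_real N h w)"
      using lip_dual_norm_convex[OF fin fw] t by simp
    then have ft: "lip_dual_norm N h (seg t v w) \<noteq> \<infinity>" by auto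
    have "lip_real N h (seg t v w) \<le> (1 - t) * lip_real N h v + t * lip_real N h w"
      using conv by (simp flip: ereal_lip_real[OF ft])
    then show "lam * lip_real N h (seg t v w) \<le> (1 - t) * (lam * lip_real N h v) + t * (lam * lip_real N h w)"
      using mult_left_mono[of _ _ lam] lam by (fastforce simp: algebra_simps)
    show "lam * lip_real N h v + \<alpha> / 2 * sq_norm N (\<lambda>p. c p - v p)
        \<le> lam * lip_real N h (seg t v w) + \<alpha> / 2 * sq_norm N (\<lambda>p. c p - seg t v w p)"
      using min[OF seg_in_V[OF v w], of t]
      by (simp add: add.commute flip: ereal_lip_real[OF ft] ereal_lip_real[OF fin])
  qed
qed

lemma u_step_variational_inequality:
  assumes opt: "is_arg_min (\<lambda>w. norm12 N (discrete_grad N h w)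
      + \<alpha> / 2 * sq_norm N (\<lambda>p. c p - w p)) (\<lambda>w. w \<in> V N) u"
    and w: "w \<in> V N"
  shows "norm12 N (discrete_grad N h u) + \<alpha> * inner_grid N (\<lambda>p. c p - u p) (\<lambda>p. w p - u p)
    \<le> norm12 N (discrete_grad N h w)"
proof (rule prox_variational_inequality[where g = "\<lambda>w. norm12 N (discrete_grad N h w)"])
  fix t :: real assume t: "0 < t" "t \<le> 1"
  show "norm12 N (discrete_grad N h (seg t u w))
      \<le> (1 - t) * norm12 N (discrete_grad N h u) + t * norm12 N (discrete_grad N h w)"
    using t by (intro total_variation_convex) auto
  have "seg t u w \<in> V N"
    using opt w by (auto simp: is_arg_min_def intro: seg_in_V)
  then show "norm12 N (discrete_grad N h u) + \<alpha> / 2 * sq_norm N (\<lambda>p. c p - u p)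
      \<le> norm12 N (discrete_grad N h (seg t u w)) + \<alpha> / 2 * sq_norm N (\<lambda>p. c p - seg t u w p)"
    using opt by (auto simp: is_arg_min_def not_less)
qed

theorem proposition1:
  fixes N :: nat and h \<alpha> lam :: real
    and f :: field2d and u v :: "nat \<Rightarrow> field2d"
  assumes "N > 0" and "h > 0" and "\<alpha> > 0" and "lam > 0"
    and "f \<in> V N"
    and "u 0 \<in> V N"
    and "\<And>n. is_arg_min
           (\<lambda>w. ereal (\<alpha> / 2 * sq_norm N (\<lambda>p. f p - u n p - w p))
                + ereal lam * lip_dual_norm N h w)
           (\<lambda>w. w \<in> V N) (v (Suc n))"
    and "\<And>n. is_arg_min
           (\<lambda>w. norm12 N (discrete_grad N h w)
                + \<alpha> / 2 * sq_norm N (\<lambda>p. f p - v (Suc n) p - w p))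
           (\<lambda>w. w \<in> V N) (u (Suc n))"
  shows "\<exists>\<mu>::real.
           is_minimum (F N h \<alpha> lam f) (V N \<times> V N) (ereal \<mu>)
           \<and> (\<forall>\<mu>'. is_minimum (F N h \<alpha> lam f) (V N \<times> V N) \<mu>' \<longrightarrow> \<mu>' = ereal \<mu>)
           \<and> (\<lambda>n. F N h \<alpha> lam f (u n, v n)) \<longlonglongrightarrow> ereal \<mu>"
proof -
  obtain us ms where us: "us \<in> V N" and ms: "ms \<in> Q N"
    and opt: "\<And>u m. u \<in> V N \<Longrightarrow> m \<in> Q N \<Longrightarrow> lifted N h \<alpha> lam f us ms \<le> lifted N h \<alpha> lam f u m"
    using lifted_minimum_exists[OF assms(2-4)] by metis
  define vs where "vs = discrete_div N h ms"
  define \<mu> where "\<mu> = lifted N h \<alpha> lam f us ms"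
  have F_min: "F N h \<alpha> lam f (us, vs) = ereal \<mu>"
    and F_ge: "\<And>u v. u \<in> V N \<Longrightarrow> ereal \<mu> \<le> F N h \<alpha> lam f (u, v)"
    using lifted_minimum_is_minimum_F[OF assms(4) us ms opt] by (auto simp: vs_def \<mu>_def)
  have vs: "vs \<in> V N" by (simp add: vs_def discrete_div_in_V)
  have vs_fin: "lip_dual_norm N h vs \<noteq> \<infinity>"
    using lip_dual_norm_div_le[OF ms, of h] by (auto simp: vs_def)
  have is_min: "is_minimum (F N h \<alpha> lam f) (V N \<times> V N) (ereal \<mu>)"
    using us vs F_min F_ge unfolding is_minimum_def by auto
  have unique: "\<mu>' = ereal \<mu>" if "is_minimum (F N h \<alpha> lam f) (V N \<times> V N) \<mu>'" for \<mu>'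
    using that is_min unfolding is_minimum_def by (metis antisym)

  have v_fin: "lip_dual_norm N h (v (Suc n)) \<noteq> \<infinity>" for n
    by (rule v_step_variational_inequality(1)[OF assms(4) assms(7)])
  have u_V: "u (Suc n) \<in> V N" for n
    using assms(8)[of n] by (simp add: is_arg_min_def)
  \<comment> \<open>The energies are taken from the first step on: \<open>v 0\<close> is arbitrary, so \<open>F (u 0, v 0)\<close> may be
    infinite.\<close>
  define E where "E = (\<lambda>n. norm12 N (discrete_grad N h (u (Suc n)))
      + \<alpha> / 2 * sq_norm N (\<lambda>p. f p - u (Suc n) p - v (Suc n) p) + lam * lip_real N h (v (Suc n)))"
  have F_E: "F N h \<alpha> lam f (u (Suc n), v (Suc n)) = ereal (E n)" for n
    unfolding E_def by (rule F_finite[OF v_fin])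
  have \<mu>_eq: "\<mu> = norm12 N (discrete_grad N h us)
      + \<alpha> / 2 * sq_norm N (\<lambda>p. f p - us p - vs p) + lam * lip_real N h vs"
    using F_min F_finite[OF vs_fin, of \<alpha> lam f us] by simp
  have "(\<lambda>n. E n - \<mu>) \<longlonglongrightarrow> 0"
  proof (rule telescoping_null_sequence[where s = "\<lambda>n. \<alpha> / 2 * sq_norm N (\<lambda>p. us p - u n p)"])
    fix n
    show "0 \<le> E n - \<mu>"
      using F_ge[OF u_V, of n "v (Suc n)"] F_E[of n] by simp
    show "0 \<le> \<alpha> / 2 * sq_norm N (\<lambda>p. us p - u n p)"
      using assms(3) sq_norm_nonneg by simp
    show "E n - \<mu> \<le> \<alpha> / 2 * sq_norm N (\<lambda>p. us p - u n p)
        - \<alpha> / 2 * sq_norm N (\<lambda>p. us p - u (Suc n) p)"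
      using alternating_step_estimate[where G = "\<lambda>v. lam * lip_real N h v"
          and J = "\<lambda>u. norm12 N (discrete_grad N h u)",
          OF less_imp_le[OF assms(3)]
          v_step_variational_inequality(2)[OF assms(4) assms(7) vs vs_fin]
          u_step_variational_inequality[OF assms(8) us]]
      unfolding E_def \<mu>_eq by (simp only: right_diff_distrib)
  qed
  then have "E \<longlonglongrightarrow> \<mu>" by (simp add: LIM_zero_iff)
  then have "(\<lambda>n. F N h \<alpha> lam f (u (Suc n), v (Suc n))) \<longlonglongrightarrow> ereal \<mu>"
    by (simp add: F_E)
  then have "(\<lambda>n. F N h \<alpha> lam f (u n, v n)) \<longlonglongrightarrow> ereal \<mu>"
    by (rule LIMSEQ_imp_Suc)
  with is_min unique show ?thesis by blast
qed

end
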